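(* Let $G$ be a finite simple graph with minimum degree $\delta \ge 3$, girth $g \ge 5$, and a cut edge $e$. Then $4\delta - 9 \le Z(G)$.
   Context: A cut edge is an edge whose removal increases the number of connected components. The girth is the length of a shortest cycle. Zero forcing process: start with an initial set $S$ of colored vertices. A colored vertex $u$ forces an uncolored neighbor $w$ (making $w$ colored) if $w$ is the only uncolored neighbor of $u$; forces are applied repeatedly. $S$ is a zero forcing set if eventually every vertex becomes colored. $Z(G)$ is the minimum size of a zero forcing set. *)

theory Defs
  imports "Graph_Theory.Digraph_Component" "HOL-Library.Extended_Nat"
begin

text \<open>
  A finite simple graph is a \<^locale>\<open>pair_graph\<close>: a finite, loop-free, symmetric digraph without
  parallel arcs.  The undirected edge between \<open>u\<close> and \<open>v\<close> is the pair of arcs \<open>(u, v)\<close>, \<open>(v, u)\<close>.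
\<close>

definition min_degree :: "'a pair_pre_digraph \<Rightarrow> nat" where
  "min_degree G = Min (out_degree (with_proj G) ` pverts G)"

text \<open>
  In a symmetric digraph the closed walk \<open>u, v, u\<close> counts as a cycle; requiring length at least 3
  leaves exactly the cycles of the undirected graph.  The girth of a forest is \<open>\<infinity>\<close>.
\<close>

definition girth :: "'a pair_pre_digraph \<Rightarrow> enat" where
  "girth G = Inf {enat (length p) | p. pre_digraph.cycle (with_proj G) p \<and> 3 \<le> length p}"

text \<open>
  For symmetric arcs the strongly connected components are the connected components.
\<close>

definition num_components :: "'a pair_pre_digraph \<Rightarrow> nat" where
  "num_components G = card (pre_digraph.sccs_verts (with_proj G))"

definition del_edge :: "'a pair_pre_digraph \<Rightarrow> 'a \<times> 'a \<Rightarrow> 'a pair_pre_digraph" where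
  "del_edge G e = G\<lparr>parcs := parcs G - {e, prod.swap e}\<rparr>"

definition cut_edge :: "'a pair_pre_digraph \<Rightarrow> 'a \<times> 'a \<Rightarrow> bool" where
  "cut_edge G e \<longleftrightarrow> e \<in> parcs G \<and> num_components G < num_components (del_edge G e)"

definition forces :: "'a pair_pre_digraph \<Rightarrow> 'a set \<Rightarrow> 'a \<Rightarrow> 'a \<Rightarrow> bool" where
  "forces G C u w \<longleftrightarrow> u \<in> C \<and> {x. (u, x) \<in> parcs G \<and> x \<notin> C} = {w}"

definition force_step :: "'a pair_pre_digraph \<Rightarrow> 'a set \<Rightarrow> 'a set \<Rightarrow> bool" where
  "force_step G C C' \<longleftrightarrow> (\<exists>u w. forces G C u w \<and> C' = insert w C)"

definition zero_forcing_set :: "'a pair_pre_digraph \<Rightarrow> 'a set \<Rightarrow> bool" where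
  "zero_forcing_set G S \<longleftrightarrow> S \<subseteq> pverts G \<and> (force_step G)\<^sup>*\<^sup>* S (pverts G)"

definition zero_forcing_number :: "'a pair_pre_digraph \<Rightarrow> nat" where
  "zero_forcing_number G = (LEAST k. \<exists>S. zero_forcing_set G S \<and> card S = k)"

end

theory Submission
  imports Defs
begin

text \<open>
  Let \<open>e = uv\<close>. At most one force runs across \<open>e\<close>, so adding its target to a zero forcing set of
  \<open>G\<close> yields a zero forcing set of \<open>G - e\<close>, which has to force the components of \<open>u\<close> and \<open>v\<close>
  separately. These have minimum degree at least \<open>d = \<delta> - 1\<close> and girth at least 5, and each
  needs \<open>2d - 2\<close> initial vertices: the first two forcing vertices of a component have at most one
  common neighbour, and none if they are adjacent, so almost all of their neighbours are distinct
  and initially coloured. Hence \<open>Z(G) + 1 \<ge> 2 (2 (\<delta> - 1) - 2)\<close>.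
\<close>

section \<open>Neighbourhoods, minimum degree and girth\<close>

abbreviation nbrs :: "'a pair_pre_digraph \<Rightarrow> 'a \<Rightarrow> 'a set" where
  "nbrs G u \<equiv> {x. (u, x) \<in> parcs G}"

lemma out_degree_eq_card_nbrs: "out_degree (with_proj G) u = card (nbrs G u)"
proof -
  have "out_arcs (with_proj G) u = Pair u ` nbrs G u"
    by (auto simp: out_arcs_def)
  then show ?thesis
    unfolding out_degree_def by (simp add: card_image inj_on_def)
qed

lemma (in pair_fin_digraph) finite_nbrs: "finite (nbrs G u)"
  by (rule finite_subset[OF _ pair_finite_verts]) (auto dest: in_arcsD2)

lemma (in pair_fin_digraph) min_degree_le_card_nbrs:
  assumes "u \<in> pverts G"
  shows "min_degree G \<le> card (nbrs G u)"
  unfolding min_degree_def out_degree_eq_card_nbrs[symmetric]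
  using assms pair_finite_verts by (intro Min_le) auto

lemma (in pair_graph) parcs_sym: "(u, v) \<in> parcs G \<Longrightarrow> (v, u) \<in> parcs G"
  using pair_sym_arcs by (auto simp: symmetric_def elim: symE)

lemma girth_le_length:
  assumes "pre_digraph.cycle (with_proj G) p" "3 \<le> length p"
  shows "girth G \<le> enat (length p)"
  unfolding girth_def using assms by (intro Inf_lower) auto

lemma (in pair_graph) no_triangle_if_girth:
  assumes "5 \<le> girth G" "(x, y) \<in> parcs G" "(y, z) \<in> parcs G"
  shows "(z, x) \<notin> parcs G"
proof
  assume zx: "(z, x) \<in> parcs G"
  have "cycle [(x, y), (y, z), (z, x)]"
    unfolding cycle_def awalk_def using assms zx
    by (auto dest: in_arcsD1 no_loops' intro!: exI[of _ x])
  from girth_le_length[OF this] have "girth G \<le> enat 3"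
    by (simp add: eval_nat_numeral)
  with assms(1) have "(5 :: enat) \<le> enat 3" by (rule order_trans)
  then show False by (simp add: numeral_eq_enat)
qed

lemma (in pair_graph) common_nbr_unique_if_girth:
  assumes "5 \<le> girth G" "x \<noteq> y" "a \<in> nbrs G x \<inter> nbrs G y" "b \<in> nbrs G x \<inter> nbrs G y"
  shows "a = b"
proof (rule ccontr)
  assume "a \<noteq> b"
  have "cycle [(x, a), (a, y), (y, b), (b, x)]"
    unfolding cycle_def awalk_def using assms \<open>a \<noteq> b\<close>
    by (auto dest: in_arcsD1 no_loops' parcs_sym intro!: exI[of _ x])
  from girth_le_length[OF this] have "girth G \<le> enat 4"
    by (simp add: eval_nat_numeral)
  with assms(1) have "(5 :: enat) \<le> enat 4" by (rule order_trans)
  then show False by (simp add: numeral_eq_enat)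
qed

section \<open>Effect of deleting an edge\<close>

lemma (in pair_graph) pair_graph_del_edge: "pair_graph (del_edge G e)"
proof
  show "symmetric (with_proj (del_edge G e))"
    by (cases e) (auto simp: symmetric_def del_edge_def intro!: symI dest: parcs_sym)
qed (auto simp: del_edge_def pair_finite_verts pair_finite_arcs dest: in_arcsD1 in_arcsD2 no_loops')

lemma girth_del_edge: "girth G \<le> girth (del_edge G e)"
  unfolding girth_def
proof (rule Inf_superset_mono, safe)
  fix p assume "pre_digraph.cycle (with_proj (del_edge G e)) p" "3 \<le> length p"
  then show "\<exists>q. enat (length p) = enat (length q) \<and>
      pre_digraph.cycle (with_proj G) q \<and> 3 \<le> length q"
    by (intro exI[of _ p])
      (auto simp: pre_digraph.cycle_def pre_digraph.awalk_def cas_with_proj_eq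
        awalk_verts_with_proj_eq del_edge_def)
qed

lemma (in pair_graph) card_nbrs_del_edge:
  "card (nbrs G x) - 1 \<le> card (nbrs (del_edge G e) x)"
proof -
  obtain u v where e: "e = (u, v)" by (cases e)
  \<comment> \<open>\<open>w\<close> is the only neighbour that \<open>x\<close> can lose. If
    \<open>x\<close> is not an end of \<open>e\<close>, it loses none and the choice of
    \<open>w\<close> is harmless.\<close>
  define w where "w = (if x = u then v else u)"
  have "nbrs G x - {w} \<subseteq> nbrs (del_edge G e) x"
    by (auto simp: e w_def del_edge_def)
  then have "card (nbrs G x - {w}) \<le> card (nbrs (del_edge G e) x)"
    by (intro card_mono pair_fin_digraph.finite_nbrs)
      (rule pair_graph.axioms pair_digraph.axioms pair_graph_del_edge)+
  then show ?thesis
    using card_Diff1_le[of "nbrs G x" w] by (auto simp: card_Diff_singleton_if split: if_splits)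
qed

text \<open>If the ends were still connected, every arc of \<open>G\<close> could be replaced by a
  walk avoiding the edge. Reachability, and with it the number of components, would then be
  unchanged.\<close>

lemma (in pair_graph) not_reachable_del_cut_edge:
  assumes "cut_edge G (u, v)"
  shows "\<not> u \<rightarrow>\<^sup>*\<^bsub>with_proj (del_edge G (u, v))\<^esub> v"
proof
  let ?H = "del_edge G (u, v)"
  interpret H: pair_graph ?H by (rule pair_graph_del_edge)
  assume uv: "u \<rightarrow>\<^sup>*\<^bsub>with_proj ?H\<^esub> v"
  then have vu: "v \<rightarrow>\<^sup>*\<^bsub>with_proj ?H\<^esub> u"
    by (rule H.symmetric_reachable')
  have arc: "x \<rightarrow>\<^sup>*\<^bsub>with_proj ?H\<^esub> y" if "(x, y) \<in> parcs G" for x y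
  proof (cases "(x, y) \<in> parcs ?H")
    case True
    then show ?thesis by (intro H.reachable_adjI) simp
  next
    case False
    with that uv vu show ?thesis by (auto simp: del_edge_def)
  qed
  have "x \<rightarrow>\<^sup>*\<^bsub>with_proj G\<^esub> y \<longleftrightarrow> x \<rightarrow>\<^sup>*\<^bsub>with_proj ?H\<^esub> y" for x y
  proof
    assume "x \<rightarrow>\<^sup>*\<^bsub>with_proj G\<^esub> y"
    then show "x \<rightarrow>\<^sup>*\<^bsub>with_proj ?H\<^esub> y"
    proof (induction rule: reachable_induct)
      case base
      then show ?case by (simp add: reachable_def del_edge_def)
    next
      case (step y z)
      from step.IH arc[OF step.hyps(2)] show ?case by (rule H.reachable_trans)
    qed
  next
    assume "x \<rightarrow>\<^sup>*\<^bsub>with_proj ?H\<^esub> y"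
    then show "x \<rightarrow>\<^sup>*\<^bsub>with_proj G\<^esub> y"
      unfolding reachable_def
      by (rule rtrancl_on_mono[rotated -1]) (auto simp: del_edge_def)
  qed
  then have "num_components G = num_components ?H"
    by (simp add: num_components_def pre_digraph.sccs_verts_def)
  with assms show False by (simp add: cut_edge_def)
qed

section \<open>Forcing after an edge deletion and inside a union of components\<close>

lemma force_step_del_edge_if_both_coloured:
  assumes "(force_step G)\<^sup>*\<^sup>* C T" "u \<in> C" "v \<in> C"
  shows "(force_step (del_edge G (u, v)))\<^sup>*\<^sup>* C T"
  using assms
proof (induction rule: converse_rtranclp_induct)
  case (step C C')
  then obtain a w where aw: "forces G C a w" "C' = insert w C"
    by (auto simp: force_step_def)
  \<comment> \<open>Deleting the edge only hides coloured neighbours, since both its ends are in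
    \<open>C\<close>.\<close>
  then have "{x. (a, x) \<in> parcs (del_edge G (u, v)) \<and> x \<notin> C} = {x. (a, x) \<in> parcs G \<and> x \<notin> C}"
    using step.prems by (auto simp: del_edge_def)
  with aw have "force_step (del_edge G (u, v)) C C'"
    by (auto simp: force_step_def forces_def)
  with step aw show ?case by (meson converse_rtranclp_into_rtranclp insertI2)
qed simp

text \<open>\<open>X\<close> holds the target of a force across the edge, if there is one. Once such
  a force has happened both ends are coloured, so the edge carries no second force; all other forces
  survive the deletion.\<close>

lemma force_step_del_edge:
  assumes "(force_step G)\<^sup>*\<^sup>* C T"
  shows "\<exists>X \<subseteq> {u, v}. card X \<le> 1 \<and> (force_step (del_edge G (u, v)))\<^sup>*\<^sup>* (C \<union> X) T"
  using assms
proof (induction rule: converse_rtranclp_induct)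
  case base
  show ?case by (intro exI[of _ "{}"]) simp
next
  case (step C C')
  let ?H = "del_edge G (u, v)"
  obtain a w where a: "a \<in> C" and w: "{x. (a, x) \<in> parcs G \<and> x \<notin> C} = {w}"
    and C': "C' = insert w C"
    using step.hyps by (auto simp: force_step_def forces_def)
  show ?case
  proof (cases "(a, w) \<in> {(u, v), (v, u)}")
    case True
    then have "(force_step ?H)\<^sup>*\<^sup>* C' T"
      using a C' step.hyps by (intro force_step_del_edge_if_both_coloured) auto
    with True C' show ?thesis by (intro exI[of _ "{w}"]) auto
  next
    case False
    obtain X where X: "X \<subseteq> {u, v}" "card X \<le> 1" "(force_step ?H)\<^sup>*\<^sup>* (C' \<union> X) T"
      using step.IH by blast
    have "(force_step ?H)\<^sup>*\<^sup>* (C \<union> X) (C' \<union> X)"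
    \<comment> \<open>A vertex of \<open>X\<close> is coloured from the start, so forcing it is an
      empty step.\<close>
    proof (cases "w \<in> X")
      case True
      then have "C \<union> X = C' \<union> X" using C' by auto
      then show ?thesis by simp
    next
      case w_X: False
      have "{x. (a, x) \<in> parcs ?H \<and> x \<notin> C \<union> X} = {w}"
        using w w_X False by (auto simp: del_edge_def)
      then have "force_step ?H (C \<union> X) (C' \<union> X)"
        using a C' by (auto simp: force_step_def forces_def)
      then show ?thesis by blast
    qed
    with X show ?thesis by (blast intro: rtranclp_trans)
  qed
qed

text \<open>\<open>A\<close> is a union of components. Until the first force into \<open>A\<close>,
  nothing in \<open>A\<close> changes, so the condition for that force can be stated with the
  initial set \<open>C\<close>. \<open>C'\<close> is the coloured set just before it; the remaining
  chain is kept so that the lemma can be applied again to find the second force.\<close>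

lemma (in pair_graph) first_force_in_closed_set:
  assumes "(force_step G)\<^sup>*\<^sup>* C T" "A \<subseteq> T" "\<not> A \<subseteq> C"
    and closed: "\<And>x y. x \<in> A \<Longrightarrow> (x, y) \<in> parcs G \<Longrightarrow> y \<in> A"
  obtains u w C' where "u \<in> C" "u \<in> A" "w \<in> A" "w \<notin> C" "nbrs G u - C = {w}"
    "C' \<inter> A = C \<inter> A" "(force_step G)\<^sup>*\<^sup>* (insert w C') T"
proof -
  have "\<exists>u w C'. u \<in> C \<and> u \<in> A \<and> w \<in> A \<and> w \<notin> C \<and> nbrs G u - C = {w} \<and>
      C' \<inter> A = C \<inter> A \<and> (force_step G)\<^sup>*\<^sup>* (insert w C') T"
    using assms(1-3)
  proof (induction rule: converse_rtranclp_induct)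
    case (step C D)
    then obtain u w where uw: "u \<in> C" "{x. (u, x) \<in> parcs G \<and> x \<notin> C} = {w}" "D = insert w C"
      by (auto simp: force_step_def forces_def)
    then have w: "(u, w) \<in> parcs G" "w \<notin> C" by auto
    show ?case
    proof (cases "w \<in> A")
      case True
      then have "u \<in> A" using w closed parcs_sym by blast
      moreover have "nbrs G u - C = {w}" using uw by auto
      ultimately show ?thesis using uw w True step.hyps by blast
    next
      case False
      then have D: "D \<inter> A = C \<inter> A" and "\<not> A \<subseteq> D" using uw step.prems by auto
      then obtain u' w' C' where *: "u' \<in> D" "u' \<in> A" "w' \<in> A" "w' \<notin> D" "nbrs G u' - D = {w'}"
        "C' \<inter> A = D \<inter> A" "(force_step G)\<^sup>*\<^sup>* (insert w' C') T"
        using step.IH step.prems by blast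
      have "nbrs G u' \<subseteq> A" using * closed by blast
      then have "nbrs G u' - C = nbrs G u' - D" using D by blast
      with * have "nbrs G u' - C = {w'}" by simp
      moreover have "u' \<in> C" "w' \<notin> C" "C' \<inter> A = C \<inter> A" using * D by blast+
      ultimately show ?thesis using *(2,3,7) by (intro exI conjI)
    qed
  qed blast
  with that show thesis by blast
qed

section \<open>Counting the initially coloured vertices in a union of components\<close>

lemma (in pair_graph) card_Un_nbrs_adjacent:
  assumes "5 \<le> girth G" "(x, y) \<in> parcs G"
  shows "card (nbrs G x \<union> nbrs G y) = card (nbrs G x) + card (nbrs G y)"
  using no_triangle_if_girth[OF assms] parcs_sym
  by (intro card_Un_disjoint finite_nbrs) blast

lemma (in pair_graph) card_coloured_closed_set:
  assumes girth: "5 \<le> girth G"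
    and forcing: "(force_step G)\<^sup>*\<^sup>* S (pverts G)"
    and A: "A \<subseteq> pverts G" "A \<noteq> {}"
    and closed: "\<And>x y. x \<in> A \<Longrightarrow> (x, y) \<in> parcs G \<Longrightarrow> y \<in> A"
    and deg: "\<And>x. x \<in> A \<Longrightarrow> d \<le> card (nbrs G x)"
    and d: "2 \<le> d"
  shows "2 * d - 2 \<le> card (S \<inter> A)"
proof -
  have fin: "finite A" using A pair_finite_verts finite_subset by blast
  have nbrs_A: "nbrs G x \<subseteq> A" if "x \<in> A" for x using that closed by blast
  \<comment> \<open>This bound settles the cases in which at most one vertex of \<open>A\<close> is
    forced.\<close>
  have card_A: "2 * d \<le> card A"
  proof -
    obtain x where x: "x \<in> A" using A by blast
    then have "card (nbrs G x) \<noteq> 0" using deg[OF x] d by linarith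
    then have "nbrs G x \<noteq> {}" by (metis card.empty)
    then obtain y where y: "(x, y) \<in> parcs G" by blast
    with x have yA: "y \<in> A" using closed by blast
    have "card (nbrs G x) + card (nbrs G y) \<le> card A"
      unfolding card_Un_nbrs_adjacent[OF girth y, symmetric]
      using nbrs_A x yA fin by (intro card_mono) auto
    with deg[OF x] deg[OF yA] show ?thesis by linarith
  qed
  show ?thesis
  proof (cases "A \<subseteq> S")
    case True
    then have "S \<inter> A = A" by blast
    with card_A show ?thesis by simp
  next
    case False
    obtain u w C where u: "u \<in> S" "u \<in> A" and w: "w \<in> A" "w \<notin> S" "nbrs G u - S = {w}"
      and C: "C \<inter> A = S \<inter> A" "(force_step G)\<^sup>*\<^sup>* (insert w C) (pverts G)"
      by (rule first_force_in_closed_set[OF forcing A(1) False closed])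
    show ?thesis
    proof (cases "A \<subseteq> insert w C")
      case True
      then have "A = insert w (S \<inter> A)" using C w by blast
      moreover have "card (insert w (S \<inter> A)) \<le> Suc (card (S \<inter> A))"
        by (rule card_insert_le_m1) auto
      ultimately have "card A \<le> Suc (card (S \<inter> A))" by simp
      with card_A show ?thesis by linarith
    next
      case False
      obtain u' w' C' where u': "u' \<in> insert w C" "u' \<in> A"
        and w': "w' \<in> A" "w' \<notin> insert w C" "nbrs G u' - insert w C = {w'}"
        by (rule first_force_in_closed_set[OF C(2) A(1) False closed])
      \<comment> \<open>All neighbours of \<open>u\<close> other than \<open>w\<close> are in
        \<open>S\<close>, so \<open>u\<close> has nothing left to force once \<open>w\<close> is
        coloured.\<close>
      have neq: "u' \<noteq> u"
      proof
        assume "u' = u"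
        then have "w' \<in> nbrs G u - S" using w' C by blast
        with w w' show False by blast
      qed
      \<comment> \<open>Counting \<open>u\<close> itself makes up for the uncoloured neighbour
        \<open>w\<close>, which gives \<open>d\<close> vertices.\<close>
      let ?N = "insert u (nbrs G u - {w})"
      have u_irr: "u \<notin> nbrs G u" "u' \<notin> nbrs G u'" by (auto dest: no_loops')
      have N: "?N \<subseteq> S \<inter> A" using u w nbrs_A[OF u(2)] by blast
      have "card (nbrs G u - {w}) = card (nbrs G u) - 1"
        using w by (intro card_Diff_singleton) blast
      then have card_N: "d \<le> card ?N"
        using deg[OF u(2)] d finite_nbrs[of u] u_irr by simp
      \<comment> \<open>At the second force \<open>w\<close> is coloured but does not belong to
        \<open>S\<close>, so it is excluded along with \<open>w'\<close>.\<close>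
      have nbrs_u': "nbrs G u' - {w, w'} \<subseteq> S \<inter> A"
        using nbrs_A[OF u'(2)] w' C by blast
      have card_nbrs_u': "card (nbrs G u' - {a, w'}) \<ge> d - 2" for a
      proof -
        have "card (nbrs G u') - card {a, w'} \<le> card (nbrs G u' - {a, w'})"
          by (rule diff_card_le_card_Diff) simp
        moreover have "card {a, w'} \<le> 2" by (simp add: card_insert_if)
        ultimately show ?thesis using deg[OF u'(2)] by linarith
      qed
      \<comment> \<open>\<open>M\<close> consists of neighbours of \<open>u'\<close>: besides
        \<open>w'\<close>, dropping a single vertex both excludes \<open>w\<close> and avoids
        \<open>?N\<close>.\<close>
      obtain M where M: "M \<subseteq> S \<inter> A" "M \<inter> ?N = {}" "d - 2 \<le> card M"
      proof (cases "(u, u') \<in> parcs G")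
        case True
        have disj: "nbrs G u' \<inter> nbrs G u = {}"
          using no_triangle_if_girth[OF girth True] parcs_sym by blast
        then have "w \<notin> nbrs G u'" using w by blast
        then have "nbrs G u' - {u, w'} \<subseteq> S \<inter> A" using nbrs_u' by blast
        then show thesis
          using disj card_nbrs_u'[of u] by (intro that[of "nbrs G u' - {u, w'}"]) auto
      next
        case False
        then have u_nin: "u \<notin> nbrs G u'" using parcs_sym by blast
        \<comment> \<open>If \<open>w\<close> is adjacent to \<open>u'\<close>, it is a common
          neighbour and hence equals \<open>a\<close>, so dropping \<open>a\<close> is
          enough.\<close>
        obtain a where a: "nbrs G u \<inter> nbrs G u' \<subseteq> {a}"
          using common_nbr_unique_if_girth[OF girth neq[symmetric]] by blast
        have "nbrs G u' - {a, w'} \<subseteq> S \<inter> A"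
          using nbrs_u' a w by blast
        then show thesis
          using a u_nin card_nbrs_u'[of a] by (intro that[of "nbrs G u' - {a, w'}"]) auto
      qed
      have "card M + card ?N = card (M \<union> ?N)"
        using M N fin by (intro card_Un_disjoint[symmetric]) (auto intro: finite_subset)
      also have "\<dots> \<le> card (S \<inter> A)"
        using M N fin by (intro card_mono) auto
      finally show ?thesis using M card_N d by linarith
    qed
  qed
qed

theorem theorem6:
  fixes G :: "'a pair_pre_digraph" and e :: "'a \<times> 'a"
  assumes "pair_graph G"
    and "3 \<le> min_degree G"
    and "5 \<le> girth G"
    and "cut_edge G e"
  shows "4 * int (min_degree G) - 9 \<le> int (zero_forcing_number G)"
proof -
  interpret G: pair_graph G by fact
  obtain u v where e: "e = (u, v)" by (cases e)
  define H where "H = del_edge G (u, v)"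
  interpret H: pair_graph H unfolding H_def by (rule G.pair_graph_del_edge)
  have verts_H: "pverts H = pverts G" by (simp add: H_def del_edge_def)
  have girth_H: "5 \<le> girth H"
    using assms(3) girth_del_edge unfolding H_def by (rule order_trans)
  have uv: "u \<in> pverts H" "v \<in> pverts H"
    using assms(4) e G.in_arcsD1 G.in_arcsD2 by (auto simp: cut_edge_def verts_H)
  have deg: "min_degree G - 1 \<le> card (nbrs H x)" if "x \<in> pverts H" for x
    using G.min_degree_le_card_nbrs[of x] G.card_nbrs_del_edge[of x "(u, v)"] that[unfolded verts_H]
    unfolding H_def by linarith

  \<comment> \<open>Some zero forcing set exists, so the \<open>LEAST\<close> is attained.\<close>
  have "zero_forcing_set G (pverts G)" by (simp add: zero_forcing_set_def)
  then have "\<exists>k S. zero_forcing_set G S \<and> card S = k" by blast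
  then have "\<exists>S. zero_forcing_set G S \<and> card S = zero_forcing_number G"
    unfolding zero_forcing_number_def by (rule LeastI_ex)
  then obtain S where S: "S \<subseteq> pverts G" "(force_step G)\<^sup>*\<^sup>* S (pverts G)"
    and card_S: "card S = zero_forcing_number G"
    by (auto simp: zero_forcing_set_def)
  obtain X where X: "X \<subseteq> {u, v}" "card X \<le> 1" "(force_step H)\<^sup>*\<^sup>* (S \<union> X) (pverts H)"
    using force_step_del_edge[OF S(2), of u v] unfolding H_def[symmetric] verts_H by blast

  define comp where "comp x = {y. x \<rightarrow>\<^sup>*\<^bsub>with_proj H\<^esub> y}" for x
  have card_comp: "2 * (min_degree G - 1) - 2 \<le> card ((S \<union> X) \<inter> comp x)" if "x \<in> pverts H" for x
  proof (rule H.card_coloured_closed_set[OF girth_H X(3)])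
    show "comp x \<subseteq> pverts H" by (auto simp: comp_def dest: H.reachable_in_verts)
    then show "min_degree G - 1 \<le> card (nbrs H y)" if "y \<in> comp x" for y
      using deg that by blast
    show "comp x \<noteq> {}" using that by (auto simp: comp_def)
    show "z \<in> comp x" if "y \<in> comp x" "(y, z) \<in> parcs H" for y z
      using that by (auto simp: comp_def intro: H.reachable_adj_trans)
  qed (use assms(2) in simp)
  have "comp u \<inter> comp v = {}"
  proof -
    have "\<not> u \<rightarrow>\<^sup>*\<^bsub>with_proj H\<^esub> v"
      unfolding H_def using assms(4)[unfolded e] by (rule G.not_reachable_del_cut_edge)
    moreover have "u \<rightarrow>\<^sup>*\<^bsub>with_proj H\<^esub> v" if "x \<in> comp u" "x \<in> comp v" for x
      using that H.reachable_trans[OF _ H.symmetric_reachable', of u x v] by (simp add: comp_def)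
    ultimately show ?thesis by (intro equals0I) (elim IntE, simp)
  qed
  have fin: "finite S" "finite X"
    using S(1) X(1) G.pair_finite_verts by (auto intro: finite_subset)
  have "card ((S \<union> X) \<inter> comp u) + card ((S \<union> X) \<inter> comp v)
      = card ((S \<union> X) \<inter> comp u \<union> (S \<union> X) \<inter> comp v)"
    using fin \<open>comp u \<inter> comp v = {}\<close> by (intro card_Un_disjoint[symmetric]) auto
  also have "\<dots> \<le> card (S \<union> X)"
    using fin by (intro card_mono) auto
  also have "\<dots> \<le> card S + 1"
    using card_Un_le[of S X] X(2) by linarith
  \<comment> \<open>The two components contribute 2 (2 (\<delta> - 1) - 2) = 4 \<delta> - 8, and the
    bound \<open>card X \<le> 1\<close> costs one more. As \<delta> is at least 3, no natural
    subtraction is truncated.\<close>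
  finally show ?thesis
    using card_comp[OF uv(1)] card_comp[OF uv(2)] card_S assms(2) by linarith
qed

end
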